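(* Let $N\in\{M,M'\}$, i.e. let $(N_b)_{b\in\mathbb{C}}$ be either the family $(M_b)_{b\in\mathbb{C}}$ or the family $(M_b')_{b\in\mathbb{C}}$ of $\mathfrak{sl}_2(\mathbb{C})$-modules. (i) For $b\in\mathbb{C}$ with $2b\ne-1$ we have $N_b\otimes L(1)\simeq N_{b-\frac12}\oplus N_{b+\frac12}$. (ii) For $2b=-1$ we have a nonsplit short exact sequence $$0\longrightarrow N_0\longrightarrow N_{-\frac12}\otimes L(1)\longrightarrow N_{-1}\longrightarrow 0.$$
   Context: $e_{i,j}$ are matrix units, $h:=\frac12(e_{1,1}-e_{2,2})$, and $\sigma$ is the algebra automorphism of $\mathbb{C}[h]$ with $\sigma(h)=h-1$. For $b\in\mathbb{C}$, $M_b$ is the vector space $\mathbb{C}[h]$ with $\mathfrak{sl}_2$-action $h\cdot f=hf$, $e_{1,2}\cdot f=(h+b)\sigma f$, $e_{2,1}\cdot f=-(h-b)\sigma^{-1}f$; and $M_b'$ is the vector space $\mathbb{C}[h]$ with $h\cdot f=hf$, $e_{1,2}\cdot f=\sigma f$, $e_{2,1}\cdot f=-(h+b+1)(h-b)\sigma^{-1}f$. $L(1)$ is the natural $2$-dimensional $\mathfrak{sl}_2$-module. Tensor products are over $\mathbb{C}$ with the usual action $x\cdot(v\otimes w)=(x\cdot v)\otimes w+v\otimes(x\cdot w)$. *)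

theory Defs
  imports
    "HOL-Analysis.Analysis"
    "HOL-Computational_Algebra.Polynomial"
    "HOL-Library.Poly_Mapping"
begin

section \<open>Complex vector spaces\<close>

class complex_vector = ab_group_add +
  fixes scaleC :: "complex \<Rightarrow> 'a \<Rightarrow> 'a"  (infixr \<open>*\<^sub>C\<close> 75)
  assumes scaleC_add_right: "a *\<^sub>C (x + y) = a *\<^sub>C x + a *\<^sub>C y"
    and scaleC_add_left: "(a + b) *\<^sub>C x = a *\<^sub>C x + b *\<^sub>C x"
    and scaleC_scaleC: "a *\<^sub>C b *\<^sub>C x = (a * b) *\<^sub>C x"
    and scaleC_one: "1 *\<^sub>C x = x"

interpretation complex_vector: vector_space "scaleC :: complex \<Rightarrow> 'a \<Rightarrow> 'a::complex_vector"
  by unfold_locales (simp_all add: scaleC_add_right scaleC_add_left scaleC_scaleC scaleC_one)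

abbreviation clinear :: "('a::complex_vector \<Rightarrow> 'b::complex_vector) \<Rightarrow> bool" where
  "clinear \<equiv> Vector_Spaces.linear scaleC scaleC"

lemma clinear_iff:
  "clinear f \<longleftrightarrow> (\<forall>x y. f (x + y) = f x + f y) \<and> (\<forall>c x. f (c *\<^sub>C x) = c *\<^sub>C f x)"
  by (auto simp: Vector_Spaces.linear_iff_module_hom module_hom_iff
      complex_vector.module_axioms)

instantiation complex :: complex_vector
begin
definition scaleC_complex_def [simp]: "scaleC (c::complex) (x::complex) = c * x"
instance by standard (simp_all add: algebra_simps)
end

instantiation prod :: (complex_vector, complex_vector) complex_vector
begin
definition scaleC_prod_def: "scaleC c p = (c *\<^sub>C fst p, c *\<^sub>C snd p)"
instance
  by standard (simp_all add: scaleC_prod_def prod_eq_iff scaleC_add_right scaleC_add_left)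
end

instantiation vec :: (complex_vector, finite) complex_vector
begin
definition scaleC_vec_def: "scaleC c x = (\<chi> i. c *\<^sub>C (x $ i))"
instance
  by standard (simp_all add: scaleC_vec_def vec_eq_iff scaleC_add_right scaleC_add_left)
end

lemma scaleC_vec_nth [simp]: "(c *\<^sub>C x) $ i = c *\<^sub>C (x $ i)"
  by (simp add: scaleC_vec_def)

instantiation poly :: (complex_vector) complex_vector
begin
definition scaleC_poly_def: "scaleC c p = map_poly (scaleC c) p"
instance
  by standard (simp_all add: scaleC_poly_def poly_eq_iff coeff_map_poly scaleC_add_right
      scaleC_add_left)
end

lemma scaleC_complex_poly: "c *\<^sub>C (p :: complex poly) = smult c p"
  by (simp add: scaleC_poly_def poly_eq_iff coeff_map_poly)

instantiation poly_mapping :: (type, complex_vector) complex_vector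
begin
definition scaleC_poly_mapping_def: "scaleC c p = Poly_Mapping.map (scaleC c) p"
lemma lookup_scaleC [simp]: "Poly_Mapping.lookup (c *\<^sub>C p) k = c *\<^sub>C Poly_Mapping.lookup p k"
  by (auto simp: scaleC_poly_mapping_def map.rep_eq when_def)
instance
  by standard (simp_all add: poly_mapping_eq_iff fun_eq_iff
      lookup_add scaleC_add_right scaleC_add_left scaleC_scaleC scaleC_one)
end


section \<open>Tensor products over the complex numbers\<close>

text \<open>
  The tensor product of \<open>'a\<close> and \<open>'b\<close> is the quotient of the free complex vector space on
  \<open>'a \<times> 'b\<close> by the subspace spanned by the bilinearity relations.
\<close>

abbreviation free_gen :: "'a \<Rightarrow> 'b \<Rightarrow> ('a \<times> 'b) \<Rightarrow>\<^sub>0 complex" where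
  "free_gen v w \<equiv> Poly_Mapping.single (v, w) 1"

definition tensor_relations :: "(('a::complex_vector \<times> 'b::complex_vector) \<Rightarrow>\<^sub>0 complex) set" where
  "tensor_relations =
     {free_gen (v + v') w - free_gen v w - free_gen v' w |v v' w. True} \<union>
     {free_gen v (w + w') - free_gen v w - free_gen v w' |v w w'. True} \<union>
     {free_gen (c *\<^sub>C v) w - c *\<^sub>C free_gen v w |c v w. True} \<union>
     {free_gen v (c *\<^sub>C w) - c *\<^sub>C free_gen v w |c v w. True}"

definition tensor_eq ::
  "(('a::complex_vector \<times> 'b::complex_vector) \<Rightarrow>\<^sub>0 complex) \<Rightarrow> (('a \<times> 'b) \<Rightarrow>\<^sub>0 complex) \<Rightarrow> bool" where
  "tensor_eq p q \<longleftrightarrow> p - q \<in> complex_vector.span tensor_relations"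

lemma equivp_tensor_eq: "equivp tensor_eq"
proof (rule equivpI)
  show "reflp tensor_eq"
    by (simp add: reflp_def tensor_eq_def complex_vector.span_zero)
  show "symp tensor_eq"
    unfolding symp_def tensor_eq_def by (metis complex_vector.span_neg minus_diff_eq)
  show "transp tensor_eq"
    unfolding transp_def tensor_eq_def
    by (force dest: complex_vector.span_add)
qed

quotient_type (overloaded) ('a, 'b) tensor =
  "('a::complex_vector \<times> 'b::complex_vector) \<Rightarrow>\<^sub>0 complex" / tensor_eq
  by (rule equivp_tensor_eq)

instantiation tensor :: (complex_vector, complex_vector) complex_vector
begin

lift_definition zero_tensor :: "('a, 'b) tensor" is 0 .

lift_definition plus_tensor :: "('a, 'b) tensor \<Rightarrow> ('a, 'b) tensor \<Rightarrow> ('a, 'b) tensor" is "(+)"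
  unfolding tensor_eq_def add_diff_add by (rule complex_vector.span_add)

lift_definition minus_tensor :: "('a, 'b) tensor \<Rightarrow> ('a, 'b) tensor \<Rightarrow> ('a, 'b) tensor" is "(-)"
proof -
  fix p p' q q' :: "('a \<times> 'b) \<Rightarrow>\<^sub>0 complex"
  assume "tensor_eq p p'" "tensor_eq q q'"
  moreover have "p - q - (p' - q') = (p - p') - (q - q')" by simp
  ultimately show "tensor_eq (p - q) (p' - q')"
    unfolding tensor_eq_def by (metis complex_vector.span_diff)
qed

lift_definition uminus_tensor :: "('a, 'b) tensor \<Rightarrow> ('a, 'b) tensor" is uminus
  unfolding tensor_eq_def minus_diff_minus by (rule complex_vector.span_neg)

lift_definition scaleC_tensor :: "complex \<Rightarrow> ('a, 'b) tensor \<Rightarrow> ('a, 'b) tensor" is scaleC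
  unfolding tensor_eq_def complex_vector.scale_right_diff_distrib[symmetric]
  by (rule complex_vector.span_scale)

instance
proof
  fix x y z :: "('a, 'b) tensor" and a b :: complex
  have refl: "tensor_eq p p" for p :: "('a \<times> 'b) \<Rightarrow>\<^sub>0 complex"
    by (simp add: tensor_eq_def complex_vector.span_zero)
  show "x + y + z = x + (y + z)" by transfer (simp add: add.assoc refl)
  show "x + y = y + x" by transfer (simp add: add.commute refl)
  show "0 + x = x" by transfer (simp add: refl)
  show "- x + x = 0" by transfer (simp add: refl)
  show "x - y = x + - y" by transfer (simp add: refl)
  show "a *\<^sub>C (x + y) = a *\<^sub>C x + a *\<^sub>C y" by transfer (simp add: scaleC_add_right refl)
  show "(a + b) *\<^sub>C x = a *\<^sub>C x + b *\<^sub>C x" by transfer (simp add: scaleC_add_left refl)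
  show "a *\<^sub>C b *\<^sub>C x = (a * b) *\<^sub>C x" by transfer (simp add: scaleC_scaleC refl)
  show "1 *\<^sub>C x = x" by transfer (simp add: scaleC_one refl)
qed

end

lift_definition pure_tensor :: "'a::complex_vector \<Rightarrow> 'b::complex_vector \<Rightarrow> ('a, 'b) tensor"
  (infixl \<open>\<otimes>\<close> 70) is free_gen .

definition cbilinear ::
  "('a::complex_vector \<Rightarrow> 'b::complex_vector \<Rightarrow> 'c::complex_vector) \<Rightarrow> bool" where
  "cbilinear B \<longleftrightarrow> (\<forall>w. clinear (\<lambda>v. B v w)) \<and> (\<forall>v. clinear (B v))"

definition free_lift :: "('a \<Rightarrow> 'b \<Rightarrow> 'c::complex_vector) \<Rightarrow> (('a \<times> 'b) \<Rightarrow>\<^sub>0 complex) \<Rightarrow> 'c" where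
  "free_lift B p = (\<Sum>(v, w)\<in>Poly_Mapping.keys p. Poly_Mapping.lookup p (v, w) *\<^sub>C B v w)"

text \<open>
  The linear map on the tensor product induced by \<open>B\<close>. When \<open>B\<close> is bilinear it does not depend
  on the representative and it is characterised by \<open>tensor_lift_pure\<close> and
  \<open>clinear_tensor_lift\<close> below.
\<close>

definition tensor_lift ::
  "('a::complex_vector \<Rightarrow> 'b::complex_vector \<Rightarrow> 'c::complex_vector) \<Rightarrow> ('a, 'b) tensor \<Rightarrow> 'c" where
  "tensor_lift B t = free_lift B (rep_tensor t)"

lemma free_lift_superset:
  assumes "finite K" "Poly_Mapping.keys p \<subseteq> K"
  shows "free_lift B p = (\<Sum>(v, w)\<in>K. Poly_Mapping.lookup p (v, w) *\<^sub>C B v w)"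
  unfolding free_lift_def
  by (rule sum.mono_neutral_left) (use assms in \<open>auto simp: in_keys_iff\<close>)

lemma clinear_free_lift: "clinear (free_lift B)"
  unfolding clinear_iff
proof (intro conjI allI)
  fix p q :: "('a \<times> 'b) \<Rightarrow>\<^sub>0 complex" and c
  let ?K = "Poly_Mapping.keys p \<union> Poly_Mapping.keys q"
  have "free_lift B (p + q) = (\<Sum>(v, w)\<in>?K. Poly_Mapping.lookup (p + q) (v, w) *\<^sub>C B v w)"
    by (rule free_lift_superset) (auto dest: subsetD[OF Poly_Mapping.keys_add])
  also have "\<dots> = free_lift B p + free_lift B q"
    by (simp add: free_lift_superset[of ?K p] free_lift_superset[of ?K q] lookup_add
        scaleC_add_left case_prod_unfold sum.distrib)
  finally show "free_lift B (p + q) = free_lift B p + free_lift B q" .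
  have "free_lift B (c *\<^sub>C p)
      = (\<Sum>(v, w)\<in>Poly_Mapping.keys p. Poly_Mapping.lookup (c *\<^sub>C p) (v, w) *\<^sub>C B v w)"
    by (rule free_lift_superset) (auto simp: in_keys_iff)
  also have "\<dots> = c *\<^sub>C free_lift B p"
    by (simp add: free_lift_def complex_vector.scale_sum_right case_prod_unfold)
  finally show "free_lift B (c *\<^sub>C p) = c *\<^sub>C free_lift B p" .
qed

lemma free_lift_gen [simp]: "free_lift B (free_gen v w) = B v w"
  by (simp add: free_lift_def scaleC_one)

lemma free_lift_tensor_eq:
  assumes B: "cbilinear B" and "tensor_eq p q"
  shows "free_lift B p = free_lift B q"
proof -
  interpret L: Vector_Spaces.linear scaleC scaleC "free_lift B"
    by (rule clinear_free_lift)
  have "free_lift B r = 0" if "r \<in> complex_vector.span tensor_relations" for r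
    using that
  proof (induction rule: complex_vector.span_induct_alt)
    case base
    then show ?case by (simp add: L.zero)
  next
    case (step c x y)
    have "free_lift B x = 0"
      using step(1) B
      by (auto simp: tensor_relations_def L.diff L.scale cbilinear_def clinear_iff)
    then show ?case using step by (simp add: L.add L.scale)
  qed
  from this[of "p - q"] assms(2) show ?thesis by (simp add: tensor_eq_def L.diff)
qed

lemma tensor_lift_abs:
  "cbilinear B \<Longrightarrow> tensor_lift B (abs_tensor p) = free_lift B p"
  unfolding tensor_lift_def
  by (rule free_lift_tensor_eq)
    (simp_all add: rep_abs_rsp_left[OF Quotient3_tensor] equivp_reflp[OF equivp_tensor_eq])

lemma tensor_lift_pure: "cbilinear B \<Longrightarrow> tensor_lift B (v \<otimes> w) = B v w"
  by (simp add: pure_tensor.abs_eq tensor_lift_abs)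

lemma clinear_tensor_lift:
  assumes "cbilinear B"
  shows "clinear (tensor_lift B)"
  unfolding clinear_iff
proof (intro conjI allI)
  interpret L: Vector_Spaces.linear scaleC scaleC "free_lift B"
    by (rule clinear_free_lift)
  fix s t c
  show "tensor_lift B (s + t) = tensor_lift B s + tensor_lift B t"
    by (induction s; induction t)
      (simp add: plus_tensor.abs_eq tensor_lift_abs[OF assms] L.add)
  show "tensor_lift B (c *\<^sub>C s) = c *\<^sub>C tensor_lift B s"
    by (induction s) (simp add: scaleC_tensor.abs_eq tensor_lift_abs[OF assms] L.scale)
qed

lemma abs_tensor_eq_iff:
  "abs_tensor p = abs_tensor q \<longleftrightarrow> p - q \<in> complex_vector.span tensor_relations"
  by (simp add: tensor.abs_eq_iff tensor_eq_def)

lemma cbilinear_pure_tensor: "cbilinear (\<otimes>)"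
  unfolding cbilinear_def clinear_iff
proof (intro conjI allI)
  fix v v' :: 'a and w w' :: 'b and c
  have base: "abs_tensor p = abs_tensor q"
    if "p - q \<in> tensor_relations" for p q :: "('a \<times> 'b) \<Rightarrow>\<^sub>0 complex"
    using that by (simp add: abs_tensor_eq_iff complex_vector.span_base)
  show "(v + v') \<otimes> w = v \<otimes> w + v' \<otimes> w"
    unfolding pure_tensor.abs_eq plus_tensor.abs_eq
    by (rule base) (simp add: tensor_relations_def diff_diff_add[symmetric]; blast)
  show "v \<otimes> (w + w') = v \<otimes> w + v \<otimes> w'"
    unfolding pure_tensor.abs_eq plus_tensor.abs_eq
    by (rule base) (simp add: tensor_relations_def diff_diff_add[symmetric]; blast)
  show "(c *\<^sub>C v) \<otimes> w = c *\<^sub>C (v \<otimes> w)"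
    unfolding pure_tensor.abs_eq scaleC_tensor.abs_eq
    by (rule base) (simp add: tensor_relations_def; blast)
  show "v \<otimes> (c *\<^sub>C w) = c *\<^sub>C (v \<otimes> w)"
    unfolding pure_tensor.abs_eq scaleC_tensor.abs_eq
    by (rule base) (simp add: tensor_relations_def; blast)
qed


section \<open>Modules over the Lie algebra sl2\<close>

type_synonym mat2 = "complex^2^2"

definition sl2 :: "mat2 set" where
  "sl2 = {x. trace x = 0}"

definition matrix_unit :: "2 \<Rightarrow> 2 \<Rightarrow> mat2" where
  "matrix_unit i j = (\<chi> k l. if k = i \<and> l = j then 1 else 0)"

definition h_elt :: mat2 where
  "h_elt = (1/2) *\<^sub>C (matrix_unit 1 1 - matrix_unit 2 2)"

text \<open>
  An action is a function on all matrices, but only its values on \<^const>\<open>sl2\<close> matter.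
\<close>

type_synonym 'v sl2_action = "mat2 \<Rightarrow> 'v \<Rightarrow> 'v"

definition sl2_module :: "'v::complex_vector sl2_action \<Rightarrow> bool" where
  "sl2_module \<rho> \<longleftrightarrow>
     (\<forall>x\<in>sl2. clinear (\<rho> x)) \<and>
     (\<forall>x\<in>sl2. \<forall>y\<in>sl2. \<forall>v. \<rho> (x + y) v = \<rho> x v + \<rho> y v) \<and>
     (\<forall>x\<in>sl2. \<forall>c v. \<rho> (c *\<^sub>C x) v = c *\<^sub>C \<rho> x v) \<and>
     (\<forall>x\<in>sl2. \<forall>y\<in>sl2. \<forall>v. \<rho> (x ** y - y ** x) v = \<rho> x (\<rho> y v) - \<rho> y (\<rho> x v))"

definition sl2_hom ::
  "'v::complex_vector sl2_action \<Rightarrow> 'w::complex_vector sl2_action \<Rightarrow> ('v \<Rightarrow> 'w) \<Rightarrow> bool" where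
  "sl2_hom \<rho> \<tau> f \<longleftrightarrow> sl2_module \<rho> \<and> sl2_module \<tau> \<and> clinear f \<and>
     (\<forall>x\<in>sl2. \<forall>v. f (\<rho> x v) = \<tau> x (f v))"

definition sl2_isomorphic ::
  "'v::complex_vector sl2_action \<Rightarrow> 'w::complex_vector sl2_action \<Rightarrow> bool" where
  "sl2_isomorphic \<rho> \<tau> \<longleftrightarrow> (\<exists>f. sl2_hom \<rho> \<tau> f \<and> bij f)"

definition direct_sum_action ::
  "'v::complex_vector sl2_action \<Rightarrow> 'w::complex_vector sl2_action \<Rightarrow> ('v \<times> 'w) sl2_action" where
  "direct_sum_action \<rho> \<tau> x p = (\<rho> x (fst p), \<tau> x (snd p))"

definition tensor_action ::
  "'v::complex_vector sl2_action \<Rightarrow> 'w::complex_vector sl2_action \<Rightarrow> ('v, 'w) tensor sl2_action" where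
  "tensor_action \<rho> \<tau> x = tensor_lift (\<lambda>v w. \<rho> x v \<otimes> w + v \<otimes> \<tau> x w)"

definition short_exact ::
  "'u::complex_vector sl2_action \<Rightarrow> 'v::complex_vector sl2_action \<Rightarrow> 'w::complex_vector sl2_action
     \<Rightarrow> ('u \<Rightarrow> 'v) \<Rightarrow> ('v \<Rightarrow> 'w) \<Rightarrow> bool" where
  "short_exact \<rho> \<tau> \<upsilon> f g \<longleftrightarrow> sl2_hom \<rho> \<tau> f \<and> sl2_hom \<tau> \<upsilon> g \<and>
     inj f \<and> range f = {v. g v = 0} \<and> surj g"

definition splits ::
  "'v::complex_vector sl2_action \<Rightarrow> 'w::complex_vector sl2_action \<Rightarrow> ('v \<Rightarrow> 'w) \<Rightarrow> bool" where
  "splits \<tau> \<upsilon> g \<longleftrightarrow> (\<exists>s. sl2_hom \<upsilon> \<tau> s \<and> g \<circ> s = id)"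

definition natural_action :: "(complex^2) sl2_action" where
  "natural_action x v = x *v v"


section \<open>The modules on polynomials in h\<close>

text \<open>The polynomial \<open>[:0, 1:]\<close> is the variable \<open>h\<close>, so that \<open>[:b, 1:]\<close> is \<open>h + b\<close>.\<close>

definition sigma :: "complex poly \<Rightarrow> complex poly" where
  "sigma f = pcompose f [:-1, 1:]"

text \<open>
  The action for which \<open>h\<close>, \<open>e\<^sub>1\<^sub>2\<close>, \<open>e\<^sub>2\<^sub>1\<close> act by \<open>H\<close>, \<open>E\<close>, \<open>F\<close>, extended linearly: a traceless
  matrix \<open>x\<close> equals \<open>2 x\<^sub>1\<^sub>1 h + x\<^sub>1\<^sub>2 e\<^sub>1\<^sub>2 + x\<^sub>2\<^sub>1 e\<^sub>2\<^sub>1\<close>.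
\<close>

definition action_from_basis ::
  "('v \<Rightarrow> 'v) \<Rightarrow> ('v \<Rightarrow> 'v) \<Rightarrow> ('v \<Rightarrow> 'v) \<Rightarrow> 'v::complex_vector sl2_action" where
  "action_from_basis H E F x v = (2 * x$1$1) *\<^sub>C H v + (x$1$2) *\<^sub>C E v + (x$2$1) *\<^sub>C F v"

definition module_M :: "complex \<Rightarrow> complex poly sl2_action" where
  "module_M b = action_from_basis
     (\<lambda>f. [:0, 1:] * f)
     (\<lambda>f. [:b, 1:] * sigma f)
     (\<lambda>f. - ([:- b, 1:] * inv sigma f))"

definition module_M' :: "complex \<Rightarrow> complex poly sl2_action" where
  "module_M' b = action_from_basis
     (\<lambda>f. [:0, 1:] * f)
     sigma
     (\<lambda>f. - ([:b + 1, 1:] * [:- b, 1:] * inv sigma f))"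


section \<open>Basic properties\<close>

lemma sl2_iff: "x \<in> sl2 \<longleftrightarrow> x$2$2 = - (x$1$1)"
  by (auto simp: sl2_def trace_def sum_2 eq_neg_iff_add_eq_0 add.commute)

lemma sl2_decomposition:
  assumes "x \<in> sl2"
  shows "x = (2 * x$1$1) *\<^sub>C h_elt + (x$1$2) *\<^sub>C matrix_unit 1 2 + (x$2$1) *\<^sub>C matrix_unit 2 1"
  using assms by (simp add: vec_eq_iff forall_2 sl2_iff h_elt_def matrix_unit_def)

lemma action_from_basis_simps:
  "action_from_basis H E F h_elt = H"
  "action_from_basis H E F (matrix_unit 1 2) = E"
  "action_from_basis H E F (matrix_unit 2 1) = F"
  by (simp_all add: fun_eq_iff action_from_basis_def h_elt_def matrix_unit_def scaleC_one)

lemma sigma_hom: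
  "sigma (f + g) = sigma f + sigma g" "sigma (f * g) = sigma f * sigma g"
  "sigma (smult c f) = smult c (sigma f)" "sigma 1 = 1" "sigma [:0, 1:] = [:0, 1:] - 1"
  by (simp_all add: sigma_def pcompose_add pcompose_mult pcompose_smult pcompose_pCons one_pCons)

lemma
  shows bij_sigma: "bij sigma"
    and inv_sigma: "inv sigma f = pcompose f [:1, 1:]"
proof -
  have 1: "sigma (pcompose f [:1, 1:]) = f" for f
    by (simp add: sigma_def pcompose_assoc[symmetric] pcompose_pCons)
  have 2: "pcompose (sigma f) [:1, 1:] = f" for f
    by (simp add: sigma_def pcompose_assoc[symmetric] pcompose_pCons)
  show "bij sigma"
    by (rule bijI'[of sigma]) (metis 1 2)+
  then show "inv sigma f = pcompose f [:1, 1:]"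
    by (metis 1 bij_inv_eq_iff)
qed

lemma action_from_basis_module:
  assumes lin: "clinear H" "clinear E" "clinear F"
    and HE: "\<And>v. H (E v) - E (H v) = E v"
    and HF: "\<And>v. H (F v) - F (H v) = - F v"
    and EF: "\<And>v. E (F v) - F (E v) = 2 *\<^sub>C H v"
  shows "sl2_module (action_from_basis H E F)"
proof -
  note l = lin[unfolded clinear_iff]
  note scale = complex_vector.scale_left_distrib complex_vector.scale_right_distrib
    complex_vector.scale_left_diff_distrib complex_vector.scale_right_diff_distrib
  have bracket: "action_from_basis H E F (x ** y - y ** x) v =
      action_from_basis H E F x (action_from_basis H E F y v) -
      action_from_basis H E F y (action_from_basis H E F x v)"
    if "x \<in> sl2" "y \<in> sl2" for x y v
  proof -
    define a b c where "a = x$1$1" and "b = x$1$2" and "c = x$2$1"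
    define a' b' c' where "a' = y$1$1" and "b' = y$1$2" and "c' = y$2$1"
    note defs = a_def b_def c_def a'_def b'_def c'_def
    have "action_from_basis H E F x (action_from_basis H E F y v) -
        action_from_basis H E F y (action_from_basis H E F x v) =
        (2 * (a * b' - a' * b)) *\<^sub>C (H (E v) - E (H v)) +
        (2 * (a * c' - a' * c)) *\<^sub>C (H (F v) - F (H v)) +
        (b * c' - b' * c) *\<^sub>C (E (F v) - F (E v))"
      by (simp add: action_from_basis_def defs[symmetric] l scale algebra_simps)
    also have "\<dots> = (2 * (b * c' - b' * c)) *\<^sub>C H v + (2 * (a * b' - a' * b)) *\<^sub>C E v +
        (2 * (c * a' - c' * a)) *\<^sub>C F v"
      unfolding HE HF EF by (simp add: scale algebra_simps)
    also have "\<dots> = action_from_basis H E F (x ** y - y ** x) v"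
      using that by (simp add: action_from_basis_def sl2_iff matrix_matrix_mult_def sum_2
          defs[symmetric] algebra_simps)
    finally show ?thesis by simp
  qed
  show ?thesis
    unfolding sl2_module_def clinear_iff
    using bracket
    by (simp add: action_from_basis_def l scale algebra_simps)
qed

lemma module_M: "sl2_module (module_M b)"
  unfolding module_M_def
  by (rule action_from_basis_module)
    (simp_all add: clinear_iff inv_sigma sigma_def scaleC_complex_poly poly_pcompose
      poly_eq_poly_eq_iff[symmetric] fun_eq_iff algebra_simps del: mult_pCons_left)

lemma module_M': "sl2_module (module_M' b)"
  unfolding module_M'_def
  by (rule action_from_basis_module)
    (simp_all add: clinear_iff inv_sigma sigma_def scaleC_complex_poly poly_pcompose
      poly_eq_poly_eq_iff[symmetric] fun_eq_iff algebra_simps del: mult_pCons_left)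

lemma natural_action_module: "sl2_module natural_action"
  by (simp add: sl2_module_def natural_action_def clinear_iff vec_eq_iff forall_2 sum_2
      matrix_vector_mult_def matrix_matrix_mult_def algebra_simps)

lemma tensor_action_linear:
  assumes "sl2_module \<rho>" "sl2_module \<tau>" "x \<in> sl2"
  shows "clinear (tensor_action \<rho> \<tau> x)"
    and "tensor_action \<rho> \<tau> x (v \<otimes> w) = \<rho> x v \<otimes> w + v \<otimes> \<tau> x w"
proof -
  have "clinear (\<rho> x)" "clinear (\<tau> x)"
    using assms by (simp_all add: sl2_module_def)
  then have "cbilinear (\<lambda>v w. \<rho> x v \<otimes> w + v \<otimes> \<tau> x w)"
    using cbilinear_pure_tensor[where 'a='a and 'b='b]
    by (simp add: cbilinear_def clinear_iff scaleC_add_right algebra_simps)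
  then show "clinear (tensor_action \<rho> \<tau> x)"
    and "tensor_action \<rho> \<tau> x (v \<otimes> w) = \<rho> x v \<otimes> w + v \<otimes> \<tau> x w"
    by (simp_all add: tensor_action_def clinear_tensor_lift tensor_lift_pure)
qed

lemma clinear_eq_on_pure:
  assumes "clinear f" "clinear g" "\<And>v w. f (v \<otimes> w) = g (v \<otimes> w)"
  shows "f t = g t"
proof -
  interpret f: Vector_Spaces.linear scaleC scaleC f by fact
  interpret g: Vector_Spaces.linear scaleC scaleC g by fact
  have "f (abs_tensor p) = g (abs_tensor p)" for p
  proof -
    let ?P = "\<lambda>K. \<Sum>k\<in>K. Poly_Mapping.lookup p k *\<^sub>C Poly_Mapping.single k 1"
    have p: "p = ?P (Poly_Mapping.keys p)"
      by (auto simp: poly_mapping_eq_iff fun_eq_iff lookup_sum lookup_single when_def if_distrib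
          in_keys_iff sum.If_cases intro!: sum.neutral cong: if_cong)
    have "f (abs_tensor (?P K)) = g (abs_tensor (?P K))" if "finite K" for K
      using that
    proof (induction K rule: finite_induct)
      case empty
      then show ?case by (simp add: zero_tensor.abs_eq[symmetric] f.zero g.zero)
    next
      case (insert k K)
      obtain v w where "k = (v, w)" by (cases k)
      with insert show ?case
        by (simp add: plus_tensor.abs_eq[symmetric] scaleC_tensor.abs_eq[symmetric]
            pure_tensor.abs_eq[symmetric] f.add g.add f.scale g.scale assms(3))
    qed
    from this[OF finite_keys[of p]] show ?thesis by (simp only: p[symmetric])
  qed
  then show ?thesis by (induction t)
qed

lemma tensor_action_module:
  assumes \<rho>: "sl2_module \<rho>" and \<tau>: "sl2_module \<tau>"
  shows "sl2_module (tensor_action \<rho> \<tau>)"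
proof -
  note lin = tensor_action_linear(1)[OF assms] and pure = tensor_action_linear(2)[OF assms]
  note \<rho>' = \<rho>[unfolded sl2_module_def clinear_iff] and \<tau>' = \<tau>[unfolded sl2_module_def clinear_iff]
  note bil = cbilinear_pure_tensor[unfolded cbilinear_def clinear_iff]
  have sub: "(v - v') \<otimes> w = v \<otimes> w - v' \<otimes> w" "v'' \<otimes> (w' - w'') = v'' \<otimes> w' - v'' \<otimes> w''"
    for v v' v'' :: 'a and w w' w'' :: 'b
    using bil by (metis add_diff_cancel diff_add_cancel)+
  have closed: "x + y \<in> sl2" "c *\<^sub>C x \<in> sl2" "x ** y - y ** x \<in> sl2"
    if "x \<in> sl2" "y \<in> sl2" for x y :: mat2 and c
    using that by (simp_all add: sl2_iff matrix_matrix_mult_def sum_2 algebra_simps)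
  note ext = clinear_eq_on_pure
  have l: "\<forall>s t. tensor_action \<rho> \<tau> x (s + t) = tensor_action \<rho> \<tau> x s + tensor_action \<rho> \<tau> x t"
      "\<forall>c t. tensor_action \<rho> \<tau> x (c *\<^sub>C t) = c *\<^sub>C tensor_action \<rho> \<tau> x t"
    if "x \<in> sl2" for x
    using lin[OF that] by (simp_all add: clinear_iff)
  have ls: "tensor_action \<rho> \<tau> x (s - t) = tensor_action \<rho> \<tau> x s - tensor_action \<rho> \<tau> x t"
    if "x \<in> sl2" for x s t
    using l[OF that] by (metis add_diff_cancel diff_add_cancel)
  show ?thesis
    unfolding sl2_module_def
  proof (intro conjI ballI allI)
    fix x y :: mat2 and c t
    assume x: "x \<in> sl2"
    show "clinear (tensor_action \<rho> \<tau> x)" by (rule lin[OF x])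
    show "tensor_action \<rho> \<tau> (c *\<^sub>C x) t = c *\<^sub>C tensor_action \<rho> \<tau> x t"
      by (rule ext[where f = "tensor_action \<rho> \<tau> (c *\<^sub>C x)"])
        (use x closed in \<open>simp_all add: lin clinear_iff l pure \<rho>' \<tau>' bil scaleC_add_right mult.commute\<close>)
    assume y: "y \<in> sl2"
    show "tensor_action \<rho> \<tau> (x + y) t = tensor_action \<rho> \<tau> x t + tensor_action \<rho> \<tau> y t"
      by (rule ext[where f = "tensor_action \<rho> \<tau> (x + y)"])
        (use x y closed in \<open>simp_all add: lin clinear_iff l pure \<rho>' \<tau>' bil scaleC_add_right add_ac\<close>)
    show "tensor_action \<rho> \<tau> (x ** y - y ** x) t =
        tensor_action \<rho> \<tau> x (tensor_action \<rho> \<tau> y t) - tensor_action \<rho> \<tau> y (tensor_action \<rho> \<tau> x t)"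
      by (rule ext[where f = "tensor_action \<rho> \<tau> (x ** y - y ** x)"])
        (use x y closed in \<open>simp_all add: lin clinear_iff l pure \<rho>' \<tau>' bil sub
          complex_vector.scale_right_diff_distrib\<close>)
  qed
qed

lemma direct_sum_action_module:
  "sl2_module \<rho> \<Longrightarrow> sl2_module \<tau> \<Longrightarrow> sl2_module (direct_sum_action \<rho> \<tau>)"
  by (simp add: sl2_module_def clinear_iff direct_sum_action_def scaleC_prod_def)

end

theory Submission
  imports Defs
begin

text \<open>
  After shifting the two components by \<open>1/2\<close> and \<open>-1/2\<close>, the module \<open>N\<^sub>b \<otimes> L(1)\<close> is free of
  rank two over the polynomials in \<open>h\<close>. It then has homomorphisms \<open>(x, y) \<mapsto> U x + V y\<close> to
  \<open>N\<^sub>c\<close> for \<open>c = b - 1/2\<close> and \<open>c = b + 1/2\<close>. The matrix of these two maps has determinant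
  \<open>- (2 b + 1)\<close>, a constant, so they give an isomorphism onto the direct sum unless \<open>2 b = -1\<close>.
  For \<open>2 b = -1\<close> the map to \<open>N\<^sub>-\<^sub>1\<close> is still surjective, with kernel \<open>N\<^sub>0\<close>; a section would
  be given by a pair of polynomials, and evaluating the equations it satisfies shows that none exists.
\<close>

section \<open>Homomorphisms of sl2-modules and transport along isomorphisms\<close>

lemma sl2_basis: "h_elt \<in> sl2" "matrix_unit 1 2 \<in> sl2" "matrix_unit 2 1 \<in> sl2"
  by (simp_all add: sl2_iff h_elt_def matrix_unit_def)

lemma sl2_module_decomposition:
  assumes \<rho>: "sl2_module \<rho>" and x: "x \<in> sl2"
  shows "\<rho> x v = (2 * x$1$1) *\<^sub>C \<rho> h_elt v + (x$1$2) *\<^sub>C \<rho> (matrix_unit 1 2) v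
    + (x$2$1) *\<^sub>C \<rho> (matrix_unit 2 1) v"
proof -
  have sum: "\<rho> (y + z) v = \<rho> y v + \<rho> z v" if "y \<in> sl2" "z \<in> sl2" for y z
    using \<rho> that by (simp add: sl2_module_def)
  have scale: "\<rho> (c *\<^sub>C y) v = c *\<^sub>C \<rho> y v" if "y \<in> sl2" for c y
    using \<rho> that by (simp add: sl2_module_def)
  have closed: "y \<in> sl2 \<Longrightarrow> z \<in> sl2 \<Longrightarrow> y + z \<in> sl2" "y \<in> sl2 \<Longrightarrow> c *\<^sub>C y \<in> sl2" for y z c
    by (simp_all add: sl2_iff)
  show ?thesis
    by (subst (1) sl2_decomposition[OF x])
      (simp only: sum scale closed sl2_basis)
qed

text \<open>Both actions are linear in the matrix, so the three basis elements of sl2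
  suffice.\<close>

lemma sl2_homI:
  assumes "sl2_module \<rho>" "sl2_module \<tau>" "clinear f"
    and "\<And>v. f (\<rho> h_elt v) = \<tau> h_elt (f v)"
    and "\<And>v. f (\<rho> (matrix_unit 1 2) v) = \<tau> (matrix_unit 1 2) (f v)"
    and "\<And>v. f (\<rho> (matrix_unit 2 1) v) = \<tau> (matrix_unit 2 1) (f v)"
  shows "sl2_hom \<rho> \<tau> f"
  unfolding sl2_hom_def
proof (intro conjI ballI allI)
  fix x v assume x: "x \<in> sl2"
  show "f (\<rho> x v) = \<tau> x (f v)"
    using assms(3)
    by (simp add: sl2_module_decomposition[OF assms(1) x, of v]
        sl2_module_decomposition[OF assms(2) x, of "f v"] assms(4-6) clinear_iff)
qed (use assms in auto)

lemma sl2_hom_compose: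
  "sl2_hom \<rho> \<tau> f \<Longrightarrow> sl2_hom \<tau> \<upsilon> g \<Longrightarrow> sl2_hom \<rho> \<upsilon> (g \<circ> f)"
  by (simp add: sl2_hom_def clinear_iff)

lemma sl2_hom_inv:
  assumes f: "sl2_hom \<rho> \<tau> f" and "bij f"
  shows "sl2_hom \<tau> \<rho> (inv f)"
proof -
  have inj: "f v = f w \<longleftrightarrow> v = w" for v w
    using \<open>bij f\<close> by (meson bij_is_inj injD)
  have r: "f (inv f w) = w" for w
    using \<open>bij f\<close> by (simp add: bij_is_surj surj_f_inv_f)
  from f show ?thesis
    by (simp add: sl2_hom_def clinear_iff inj[symmetric] r)
qed

lemma sl2_isomorphic_trans:
  "sl2_isomorphic \<rho> \<tau> \<Longrightarrow> sl2_isomorphic \<tau> \<upsilon> \<Longrightarrow> sl2_isomorphic \<rho> \<upsilon>"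
  unfolding sl2_isomorphic_def by (meson sl2_hom_compose bij_comp)

lemma short_exact_transport:
  assumes "sl2_hom \<tau> \<tau>' T" "bij T" "short_exact \<rho> \<tau>' \<upsilon> f g"
  shows "short_exact \<rho> \<tau> \<upsilon> (inv T \<circ> f) (g \<circ> T)"
proof -
  have T: "T (inv T w) = w" "inv T (T v) = v" for v w
    using \<open>bij T\<close> by (simp_all add: bij_is_surj surj_f_inv_f bij_is_inj)
  have "range (inv T \<circ> f) = {v. T v \<in> range f}"
    by (auto simp: T image_iff) (metis T(2))+
  moreover have "surj (g \<circ> T)"
    using assms by (intro comp_surj) (auto simp: short_exact_def bij_is_surj)
  moreover have "inj (inv T \<circ> f)"
    using assms by (intro inj_compose) (auto simp: short_exact_def bij_is_inj bij_imp_bij_inv)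
  moreover have "sl2_hom \<rho> \<tau> (inv T \<circ> f)" "sl2_hom \<tau> \<upsilon> (g \<circ> T)"
    using assms sl2_hom_compose sl2_hom_inv unfolding short_exact_def by blast+
  moreover have "{v. T v \<in> range f} = {v. (g \<circ> T) v = 0}"
    using assms(3) by (simp add: short_exact_def)
  ultimately show ?thesis
    by (simp add: short_exact_def)
qed

text \<open>If \<open>s\<close> is a section of \<open>g \<circ> T\<close>, then
  \<open>T \<circ> s\<close> is one of \<open>g\<close>. Used contrapositively: nonsplitness passes
  from \<open>g\<close> to \<open>g \<circ> T\<close>.\<close>

lemma splits_transport:
  assumes "sl2_hom \<tau> \<tau>' T" "splits \<tau> \<upsilon> (g \<circ> T)"
  shows "splits \<tau>' \<upsilon> g"
proof -
  from assms(2) obtain s where "sl2_hom \<upsilon> \<tau> s" "g \<circ> T \<circ> s = id"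
    unfolding splits_def by blast
  then have "sl2_hom \<upsilon> \<tau>' (T \<circ> s)" "g \<circ> (T \<circ> s) = id"
    using assms(1) by (auto intro: sl2_hom_compose simp: comp_assoc)
  then show ?thesis
    unfolding splits_def by blast
qed

section \<open>A concrete model of the tensor product\<close>

text \<open>Common shape of both families, so that the tensor product with L(1) is computed once for
  arbitrary coefficients.\<close>

definition shift_action :: "complex poly \<Rightarrow> complex poly \<Rightarrow> complex poly sl2_action" where
  "shift_action A B = action_from_basis
     (\<lambda>f. [:0, 1:] * f) (\<lambda>f. A * sigma f) (\<lambda>f. - (B * inv sigma f))"

lemma module_M_eq: "module_M b = shift_action [:b, 1:] [:- b, 1:]"
  by (simp add: module_M_def shift_action_def)

lemma module_M'_eq: "module_M' b = shift_action 1 ([:b + 1, 1:] * [:- b, 1:])"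
  by (simp add: module_M'_def shift_action_def)

text \<open>
  The tensor product of \<open>shift_action A B\<close> with the natural module, where
  \<open>f \<otimes> e\<^sub>1 + g \<otimes> e\<^sub>2\<close> is written as the pair \<open>(f(h - 1/2), g(h + 1/2))\<close>, which makes \<open>h\<close> act by
  multiplication on both components.
\<close>

definition pair_action :: "complex poly \<Rightarrow> complex poly \<Rightarrow> (complex poly \<times> complex poly) sl2_action" where
  "pair_action A B = action_from_basis
     (\<lambda>(x, y). ([:0, 1:] * x, [:0, 1:] * y))
     (\<lambda>(x, y). (pcompose A [:-1/2, 1:] * sigma x + sigma y, pcompose A [:1/2, 1:] * sigma y))
     (\<lambda>(x, y). (- (pcompose B [:-1/2, 1:] * inv sigma x),
        inv sigma x - pcompose B [:1/2, 1:] * inv sigma y))"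

definition pair_of_tensor :: "(complex poly, complex^2) tensor \<Rightarrow> complex poly \<times> complex poly" where
  "pair_of_tensor = tensor_lift (\<lambda>f w.
     (smult (w$1) (pcompose f [:-1/2, 1:]), smult (w$2) (pcompose f [:1/2, 1:])))"

text \<open>This is the relation [e12, e21] = 2h applied to the constant 1 and evaluated at
  \<open>z\<close>.\<close>

lemma sl2_module_shift_actionD:
  assumes "sl2_module (shift_action A B)"
  shows "poly A (z + 1) * poly B z - poly A z * poly B (z - 1) = 2 * z"
proof -
  let ?\<rho> = "shift_action A B" and ?e = "matrix_unit 1 2" and ?f = "matrix_unit 2 1"
  have "?\<rho> (?e ** ?f - ?f ** ?e) 1 = ?\<rho> ?e (?\<rho> ?f 1) - ?\<rho> ?f (?\<rho> ?e 1)"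
    using assms sl2_basis by (simp add: sl2_module_def)
  also have "?e ** ?f - ?f ** ?e = 2 *\<^sub>C h_elt"
    by (simp add: vec_eq_iff forall_2 matrix_matrix_mult_def sum_2 h_elt_def matrix_unit_def)
  also have "?\<rho> (2 *\<^sub>C h_elt) 1 = 2 *\<^sub>C ?\<rho> h_elt 1"
    using assms sl2_basis by (simp add: sl2_module_def)
  finally have "poly (2 *\<^sub>C ?\<rho> h_elt 1) z = poly (?\<rho> ?e (?\<rho> ?f 1) - ?\<rho> ?f (?\<rho> ?e 1)) z"
    by simp
  then show ?thesis
    by (simp add: shift_action_def action_from_basis_simps scaleC_complex_poly inv_sigma
        sigma_def poly_pcompose algebra_simps)
qed

lemma sl2_module_pair_action:
  assumes "sl2_module (shift_action A B)"
  shows "sl2_module (pair_action A B)"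
proof -
  note eq = sl2_module_shift_actionD[OF assms]
  \<comment> \<open>The bracket of e12 and e21 on the two components needs the functional equation
    at \<open>z - 1/2\<close> and at \<open>z + 1/2\<close>. The off-diagonal terms of the pair
    action contribute \<open>w\<close> and \<open>- w\<close>, which turn \<open>2 * z - 1\<close>
    and \<open>2 * z + 1\<close> into \<open>2 * z\<close>.\<close>
  have 1: "w + w * (poly A (z + 1/2) * poly B (z - 1/2))
      = z * (2 * w) + w * (poly A (z - 1/2) * poly B (z - 3/2))" for z w
    using arg_cong[OF eq[of "z - 1/2"], of "(*) w"] by (simp add: algebra_simps)
  have 2: "w * (poly B (z + 1/2) * poly A (z + 3/2))
      = w + (z * (2 * w) + w * (poly A (z + 1/2) * poly B (z - 1/2)))" for z w
    using arg_cong[OF eq[of "z + 1/2"], of "(*) w"] by (simp add: algebra_simps)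
  show ?thesis
    unfolding pair_action_def
    by (rule action_from_basis_module)
     (simp_all add: clinear_iff inv_sigma sigma_def scaleC_prod_def scaleC_complex_poly poly_pcompose
        poly_eq_poly_eq_iff[symmetric] fun_eq_iff algebra_simps split_beta prod_eq_iff 1 2
        del: mult_pCons_left)
qed

lemma cbilinear_pair:
  "cbilinear (\<lambda>f w. (smult (w$1) (pcompose f [:-1/2, 1:]),
     smult ((w::complex^2)$2) (pcompose f [:1/2, 1:])))"
  by (simp add: cbilinear_def clinear_iff scaleC_prod_def scaleC_complex_poly pcompose_add
      pcompose_smult smult_add_left smult_add_right mult.commute)

lemmas pair_of_tensor_pure =
  tensor_lift_pure[OF cbilinear_pair, folded pair_of_tensor_def]

lemmas clinear_pair_of_tensor =
  clinear_tensor_lift[OF cbilinear_pair, folded pair_of_tensor_def]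

lemma bij_pair_of_tensor: "bij pair_of_tensor"
proof -
  \<comment> \<open>The inverse undoes the half shifts and attaches the entries to the standard
    basis of L(1).\<close>
  define S :: "complex poly \<times> complex poly \<Rightarrow> (complex poly, complex^2) tensor" where
    "S p = pcompose (fst p) [:1/2, 1:] \<otimes> axis 1 1 + pcompose (snd p) [:-1/2, 1:] \<otimes> axis 2 1" for p
  note bil = cbilinear_pure_tensor[unfolded cbilinear_def clinear_iff]
  note lin = clinear_pair_of_tensor[unfolded clinear_iff]
  have smult: "smult c f \<otimes> w = c *\<^sub>C (f \<otimes> w)" for c f and w :: "complex^2"
    by (simp only: scaleC_complex_poly[symmetric] bil)
  have "clinear S"
    by (simp add: S_def clinear_iff scaleC_prod_def scaleC_complex_poly pcompose_add
        pcompose_smult scaleC_add_right bil smult)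
  have 1: "pair_of_tensor (S p) = p" for p
    by (simp add: S_def lin pair_of_tensor_pure axis_def prod_eq_iff pcompose_assoc[symmetric]
        pcompose_pCons)
  have "(S \<circ> pair_of_tensor) t = id t" for t
  proof (rule clinear_eq_on_pure[where f = "S \<circ> pair_of_tensor" and g = id])
    show "clinear (S \<circ> pair_of_tensor)"
      using \<open>clinear S\<close> lin by (simp add: clinear_iff del: split_paired_All)
    show "clinear (id :: (complex poly, complex^2) tensor \<Rightarrow> (complex poly, complex^2) tensor)"
      by (simp add: clinear_iff)
    fix f :: "complex poly" and w :: "complex^2"
    have w: "w = w$1 *\<^sub>C axis 1 1 + w$2 *\<^sub>C axis 2 1"
      by (simp add: vec_eq_iff forall_2 axis_def)
    have "S (pair_of_tensor (f \<otimes> w)) = f \<otimes> (w$1 *\<^sub>C axis 1 1 + w$2 *\<^sub>C axis 2 1)"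
      by (simp add: S_def pair_of_tensor_pure pcompose_smult pcompose_assoc[symmetric]
          pcompose_pCons bil smult)
    then show "(S \<circ> pair_of_tensor) (f \<otimes> w) = id (f \<otimes> w)"
      by (simp only: w[symmetric] o_apply id_apply)
  qed
  then show ?thesis
    using 1 by (intro o_bij[of S]) auto
qed

lemma sl2_hom_pair_of_tensor:
  assumes \<rho>: "sl2_module (shift_action A B)"
  shows "sl2_hom (tensor_action (shift_action A B) natural_action) (pair_action A B) pair_of_tensor"
proof (rule sl2_homI)
  note T = tensor_action_linear[OF \<rho> natural_action_module]
  note lin = clinear_pair_of_tensor[unfolded clinear_iff]
  show "sl2_module (tensor_action (shift_action A B) natural_action)"
    by (rule tensor_action_module[OF \<rho> natural_action_module])
  show P: "sl2_module (pair_action A B)"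
    by (rule sl2_module_pair_action[OF \<rho>])
  show "clinear pair_of_tensor"
    by (rule clinear_pair_of_tensor)
  \<comment> \<open>Both sides are linear in \<open>t\<close>, so pure tensors suffice.\<close>
  have ext: "pair_of_tensor (tensor_action (shift_action A B) natural_action x t)
      = pair_action A B x (pair_of_tensor t)"
    if "x \<in> sl2" and "\<And>f w. pair_of_tensor (tensor_action (shift_action A B) natural_action x (f \<otimes> w))
      = pair_action A B x (pair_of_tensor (f \<otimes> w))" for x t
  proof (rule clinear_eq_on_pure)
    show "clinear (\<lambda>t. pair_of_tensor (tensor_action (shift_action A B) natural_action x t))"
      using T(1)[OF that(1)] lin by (simp add: clinear_iff)
    have "clinear (pair_action A B x)"
      using P that(1) by (simp add: sl2_module_def)
    then show "clinear (\<lambda>t. pair_action A B x (pair_of_tensor t))"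
      using lin by (simp add: clinear_iff del: split_paired_All)
  qed (rule that(2))
  note T = T(2)[OF sl2_basis(1)] T(2)[OF sl2_basis(2)] T(2)[OF sl2_basis(3)]
  have entries: "h_elt $ 1 $ 1 = 1/2" "h_elt $ 1 $ 2 = 0" "h_elt $ 2 $ 1 = 0" "h_elt $ 2 $ 2 = -1/2"
    "matrix_unit i j $ k $ l = (if k = i \<and> l = j then 1 else 0)" for i j k l
    by (simp_all add: h_elt_def matrix_unit_def)
  note simps = shift_action_def pair_action_def action_from_basis_simps
    pair_of_tensor_pure natural_action_def matrix_vector_mult_def sum_2 inv_sigma sigma_def
    poly_pcompose poly_eq_poly_eq_iff[symmetric] fun_eq_iff entries
  show "pair_of_tensor (tensor_action (shift_action A B) natural_action h_elt t)
      = pair_action A B h_elt (pair_of_tensor t)" for t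
    by (rule ext, rule sl2_basis, simp only: T lin)
      (simp add: simps algebra_simps del: mult_pCons_left)
  show "pair_of_tensor (tensor_action (shift_action A B) natural_action (matrix_unit 1 2) t)
      = pair_action A B (matrix_unit 1 2) (pair_of_tensor t)" for t
    by (rule ext, rule sl2_basis, simp only: T lin)
      (simp add: simps algebra_simps del: mult_pCons_left)
  show "pair_of_tensor (tensor_action (shift_action A B) natural_action (matrix_unit 2 1) t)
      = pair_action A B (matrix_unit 2 1) (pair_of_tensor t)" for t
    by (rule ext, rule sl2_basis, simp only: T lin)
      (simp add: simps algebra_simps del: mult_pCons_left)
qed

section \<open>Homomorphisms given by polynomial coefficients\<close>

text \<open>Such a map commutes with h automatically. The first two equations compare the
  coefficients of \<open>sigma f\<close> under e12, the last two those of \<open>inv sigma f\<close>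
  under e21.\<close>

lemma sl2_hom_into_pair:
  assumes "sl2_module (shift_action A B)" "sl2_module (shift_action A' B')"
    and "\<And>z. poly A' z * poly P z = poly A (z - 1/2) * poly P (z - 1) + poly Q (z - 1)"
    and "\<And>z. poly A' z * poly Q z = poly A (z + 1/2) * poly Q (z - 1)"
    and "\<And>z. poly B' z * poly P z = poly B (z - 1/2) * poly P (z + 1)"
    and "\<And>z. poly B' z * poly Q z = poly B (z + 1/2) * poly Q (z + 1) - poly P (z + 1)"
  shows "sl2_hom (shift_action A' B') (pair_action A B) (\<lambda>f. (P * f, Q * f))"
proof (rule sl2_homI)
  \<comment> \<open>The factor \<open>w\<close> stands for the value of \<open>f\<close> at the
    shifted argument.\<close>
  have eqs: "poly P z * (poly A' z * w) = (poly A (z - 1/2) * poly P (z - 1) + poly Q (z - 1)) * w"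
    "poly Q z * (poly A' z * w) = (poly A (z + 1/2) * poly Q (z - 1)) * w"
    "poly P z * (poly B' z * w) = (poly B (z - 1/2) * poly P (z + 1)) * w"
    "poly Q z * (poly B' z * w) = (poly B (z + 1/2) * poly Q (z + 1) - poly P (z + 1)) * w"
    for z w by (simp_all flip: assms(3-6))
  note simps = shift_action_def pair_action_def action_from_basis_simps inv_sigma sigma_def
    poly_pcompose poly_eq_poly_eq_iff[symmetric] fun_eq_iff
  show "clinear (\<lambda>f. (P * f, Q * f))"
    by (simp add: clinear_iff scaleC_prod_def scaleC_complex_poly algebra_simps)
  fix f
  show "(P * shift_action A' B' h_elt f, Q * shift_action A' B' h_elt f)
      = pair_action A B h_elt (P * f, Q * f)"
    by (simp add: simps del: mult_pCons_left)
  show "(P * shift_action A' B' (matrix_unit 1 2) f, Q * shift_action A' B' (matrix_unit 1 2) f)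
      = pair_action A B (matrix_unit 1 2) (P * f, Q * f)"
    by (simp add: simps eqs del: mult_pCons_left) (simp add: algebra_simps)
  show "(P * shift_action A' B' (matrix_unit 2 1) f, Q * shift_action A' B' (matrix_unit 2 1) f)
      = pair_action A B (matrix_unit 2 1) (P * f, Q * f)"
    by (simp add: simps eqs del: mult_pCons_left) (simp add: algebra_simps)
qed (use assms sl2_module_pair_action in auto)

text \<open>The e12 and e21 conditions each split into two, because the entries of the pair are
  independent: the equations are the coefficients of the shifted first and second entry.\<close>

lemma sl2_hom_from_pair:
  assumes "sl2_module (shift_action A B)" "sl2_module (shift_action A' B')"
    and "\<And>z. poly A' z * poly U (z - 1) = poly A (z - 1/2) * poly U z"
    and "\<And>z. poly A' z * poly V (z - 1) = poly A (z + 1/2) * poly V z + poly U z"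
    and "\<And>z. poly B' z * poly U (z + 1) = poly B (z - 1/2) * poly U z - poly V z"
    and "\<And>z. poly B' z * poly V (z + 1) = poly B (z + 1/2) * poly V z"
  shows "sl2_hom (pair_action A B) (shift_action A' B') (\<lambda>p. U * fst p + V * snd p)"
proof (rule sl2_homI)
  have eqs: "poly A' z * (poly U (z - 1) * w) = (poly A (z - 1/2) * poly U z) * w"
    "poly A' z * (poly V (z - 1) * w) = (poly A (z + 1/2) * poly V z + poly U z) * w"
    "poly B' z * (poly U (z + 1) * w) = (poly B (z - 1/2) * poly U z - poly V z) * w"
    "poly B' z * (poly V (z + 1) * w) = (poly B (z + 1/2) * poly V z) * w"
    for z w by (simp_all flip: assms(3-6))
  note simps = shift_action_def pair_action_def action_from_basis_simps inv_sigma sigma_def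
    poly_pcompose poly_eq_poly_eq_iff[symmetric] fun_eq_iff split_beta
  show "clinear (\<lambda>p. U * fst p + V * snd p)"
    by (simp add: clinear_iff scaleC_prod_def scaleC_complex_poly algebra_simps smult_add_right)
  fix p
  show "U * fst (pair_action A B h_elt p) + V * snd (pair_action A B h_elt p)
      = shift_action A' B' h_elt (U * fst p + V * snd p)"
    by (simp add: simps algebra_simps del: mult_pCons_left)
  show "U * fst (pair_action A B (matrix_unit 1 2) p) + V * snd (pair_action A B (matrix_unit 1 2) p)
      = shift_action A' B' (matrix_unit 1 2) (U * fst p + V * snd p)"
    by (simp add: simps eqs distrib_left[of "poly A' _"] add.commute[of _ "-1"] del: mult_pCons_left)
      (simp add: algebra_simps eqs)
  show "U * fst (pair_action A B (matrix_unit 2 1) p) + V * snd (pair_action A B (matrix_unit 2 1) p)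
      = shift_action A' B' (matrix_unit 2 1) (U * fst p + V * snd p)"
    by (simp add: simps eqs distrib_left[of "poly B' _"] del: mult_pCons_left)
      (simp add: algebra_simps eqs)
qed (use assms sl2_module_pair_action in auto)

section \<open>Criteria for a direct sum and for a nonsplit extension\<close>

lemma sl2_hom_direct_sum:
  "sl2_hom \<rho> \<tau> f \<Longrightarrow> sl2_hom \<rho> \<upsilon> g \<Longrightarrow> sl2_hom \<rho> (direct_sum_action \<tau> \<upsilon>) (\<lambda>v. (f v, g v))"
  by (simp add: sl2_hom_def direct_sum_action_module clinear_iff scaleC_prod_def)
    (simp add: direct_sum_action_def)

lemma pair_action_decomposable:
  assumes "sl2_module (shift_action A B)" "sl2_module (shift_action A1 B1)" "sl2_module (shift_action A2 B2)"
    and "sl2_hom (pair_action A B) (shift_action A1 B1) (\<lambda>p. U1 * fst p + V1 * snd p)"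
    and "sl2_hom (pair_action A B) (shift_action A2 B2) (\<lambda>p. U2 * fst p + V2 * snd p)"
    and det: "U1 * V2 - U2 * V1 = [:d:]" and "d \<noteq> 0"
  shows "sl2_isomorphic (tensor_action (shift_action A B) natural_action)
    (direct_sum_action (shift_action A1 B1) (shift_action A2 B2))"
proof (rule sl2_isomorphic_trans)
  show "sl2_isomorphic (tensor_action (shift_action A B) natural_action) (pair_action A B)"
    using sl2_hom_pair_of_tensor[OF assms(1)] bij_pair_of_tensor
    unfolding sl2_isomorphic_def by blast
  let ?G = "\<lambda>p. (U1 * fst p + V1 * snd p, U2 * fst p + V2 * snd p)"
  let ?D = "smult (1 / d)"
  \<comment> \<open>The adjugate matrix divided by \<open>d\<close>; its entries are again
    polynomials because the determinant is constant.\<close>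
  let ?G' = "\<lambda>p. (?D (V2 * fst p - V1 * snd p), ?D (U1 * snd p - U2 * fst p))"
  have D: "?D ((U1 * V2 - U2 * V1) * q) = q" for q
    using \<open>d \<noteq> 0\<close> by (simp add: det)
  have "?G' (?G p) = p" for p
    using D[of "fst p"] D[of "snd p"] by (simp add: prod_eq_iff algebra_simps)
  moreover have "?G (?G' p) = p" for p
    using D[of "fst p"] D[of "snd p"]
    by (simp add: prod_eq_iff smult_add_right[symmetric] smult_diff_right[symmetric])
      (simp add: algebra_simps)
  ultimately have "bij ?G"
    by (intro o_bij[of ?G']) (auto simp: fun_eq_iff)
  then show "sl2_isomorphic (pair_action A B)
      (direct_sum_action (shift_action A1 B1) (shift_action A2 B2))"
    using sl2_hom_direct_sum[OF assms(4,5)] unfolding sl2_isomorphic_def by blast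
qed

lemma short_exact_tensor:
  assumes "sl2_module (shift_action A B)"
    and "short_exact \<rho> (pair_action A B) \<upsilon> f g"
    and "\<not> splits (pair_action A B) \<upsilon> g"
  shows "\<exists>f g. short_exact \<rho> (tensor_action (shift_action A B) natural_action) \<upsilon> f g \<and>
    \<not> splits (tensor_action (shift_action A B) natural_action) \<upsilon> g"
  using short_exact_transport[OF sl2_hom_pair_of_tensor[OF assms(1)] bij_pair_of_tensor assms(2)]
    splits_transport[OF sl2_hom_pair_of_tensor[OF assms(1)]] assms(3) by blast

text \<open>Since h acts by multiplication on both sides, \<open>s\<close> is linear over the
  polynomials in h, and 1 generates its source.\<close>

lemma sl2_hom_from_shift_to_pair:
  assumes s: "sl2_hom (shift_action A' B') (pair_action A B) s"
  shows "s f = (f * fst (s 1), f * snd (s 1))"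
proof (induction f)
  have lin: "s (f + g) = s f + s g" "s (c *\<^sub>C f) = c *\<^sub>C s f" for f g c
    using s by (simp_all add: sl2_hom_def clinear_iff)
  case 0
  show ?case
    using lin(1)[of 0 0] by (simp add: zero_prod_def)
  case (pCons a f)
  have "pCons a f = a *\<^sub>C 1 + shift_action A' B' h_elt f"
    by (simp add: scaleC_complex_poly shift_action_def action_from_basis_simps one_pCons)
  then have "s (pCons a f) = a *\<^sub>C s 1 + s (shift_action A' B' h_elt f)"
    by (simp only: lin)
  also have "s (shift_action A' B' h_elt f) = pair_action A B h_elt (s f)"
    using s sl2_basis by (simp add: sl2_hom_def)
  finally show ?case
    by (simp add: pCons.IH pair_action_def action_from_basis_simps scaleC_prod_def
        scaleC_complex_poly prod_eq_iff)
qed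

text \<open>
  A section \<open>s\<close> is determined by the pair \<open>s 1\<close>. Evaluating the \<open>e\<^sub>2\<^sub>1\<close>-equation at \<open>-1\<close>
  makes its first entry vanish at \<open>0\<close>. The second entry does not contribute to the value of
  \<open>g (s 1)\<close> at \<open>0\<close> either: for \<open>M'\<close> because \<open>P(0) = 0\<close>, for \<open>M\<close> by the \<open>e\<^sub>1\<^sub>2\<close>-equation at \<open>0\<close>.
\<close>

lemma nonsplit_extension_pair:
  assumes "sl2_hom \<rho> (pair_action A B) (\<lambda>f. (P * f, f))"
    and "sl2_hom (pair_action A B) (shift_action A' B') (\<lambda>p. fst p - P * snd p)"
    and B: "poly B' (-1) = 0" "poly B (-3/2) \<noteq> 0"
    and A: "poly P 0 = 0 \<or> poly A' 0 \<noteq> 0 \<and> poly A (1/2) = 0"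
  defines "g \<equiv> \<lambda>p. fst p - P * snd p"
  shows "short_exact \<rho> (pair_action A B) (shift_action A' B') (\<lambda>f. (P * f, f)) g"
    and "\<not> splits (pair_action A B) (shift_action A' B') g"
proof -
  have "surj g"
    by (rule surjI[of _ "\<lambda>f. (f, 0)"]) (simp add: g_def)
  \<comment> \<open>The kernel of \<open>g\<close> consists of the pairs \<open>(P * y, y)\<close>,
    which is the range of the embedding.\<close>
  with assms(1,2) show "short_exact \<rho> (pair_action A B) (shift_action A' B') (\<lambda>f. (P * f, f)) g"
    by (auto simp: short_exact_def inj_def g_def)
  show "\<not> splits (pair_action A B) (shift_action A' B') g"
  proof
    assume "splits (pair_action A B) (shift_action A' B') g"
    then obtain s where s: "sl2_hom (shift_action A' B') (pair_action A B) s" and id: "g \<circ> s = id"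
      by (auto simp: splits_def)
    define x y where "x = fst (s 1)" and "y = snd (s 1)"
    have s_eq: "s f = (f * x, f * y)" for f
      unfolding x_def y_def by (rule sl2_hom_from_shift_to_pair[OF s])
    have act: "s (shift_action A' B' u 1) = pair_action A B u (s 1)" if "u \<in> sl2" for u
      using s that by (simp add: sl2_hom_def)
    note simps = s_eq shift_action_def pair_action_def action_from_basis_simps inv_sigma sigma_def
      pcompose_1 poly_pcompose
    have "- (B' * x) = - (pcompose B [:-1/2, 1:] * pcompose x [:1, 1:])"
      using act[OF sl2_basis(3)] by (simp add: simps)
    then have "poly (B' * x) (-1) = poly (pcompose B [:-1/2, 1:] * pcompose x [:1, 1:]) (-1)"
      by simp
    then have x: "poly x 0 = 0"
      using B by (simp add: poly_pcompose)
    have "A' * y = pcompose A [:1/2, 1:] * pcompose y [:-1, 1:]"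
      using act[OF sl2_basis(2)] by (simp add: simps)
    then have "poly (A' * y) 0 = poly (pcompose A [:1/2, 1:] * pcompose y [:-1, 1:]) 0"
      by simp
    then have "poly P 0 * poly y 0 = 0"
      using A by (auto simp: poly_pcompose)
    moreover have "x - P * y = 1"
      using fun_cong[OF id, of 1] by (simp add: g_def s_eq)
    then have "poly (x - P * y) 0 = 1"
      by simp
    ultimately show False
      using x by auto
  qed
qed

section \<open>The families \<open>M\<close> and \<open>M'\<close>\<close>

lemmas shift_module_M = module_M[unfolded module_M_eq]
lemmas shift_module_M' = module_M'[unfolded module_M'_eq]

lemma module_M_tensor_decomposition:
  assumes "2 * b \<noteq> -1"
  shows "sl2_isomorphic (tensor_action (module_M b) natural_action)
    (direct_sum_action (module_M (b - 1/2)) (module_M (b + 1/2)))"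
  unfolding module_M_eq
proof (rule pair_action_decomposable[OF shift_module_M shift_module_M shift_module_M])
  \<comment> \<open>This identity also fixes the coefficients: \<open>U1 = -1\<close>,
    \<open>V1 = 1\<close>, \<open>U2 = h + b + 1/2\<close>, \<open>V2 = b + 1/2 - h\<close>. A
    constant \<open>U1\<close> is possible as \<open>A1(h) = A(h - 1/2)\<close>; in each case the
    third equation of \<open>sl2_hom_from_pair\<close> determines \<open>V\<close> from
    \<open>U\<close>.\<close>
  show "- 1 * [:b + 1/2, -1:] - [:b + 1/2, 1:] * 1 = [:- (2 * b + 1):]"
    by (simp add: algebra_simps one_pCons)
  show "- (2 * b + 1) \<noteq> 0"
    using assms by (simp only: neg_equal_0_iff_equal eq_neg_iff_add_eq_0 not_False_eq_True)
qed (rule sl2_hom_from_pair[OF shift_module_M shift_module_M];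
    simp add: field_simps)+

lemma module_M'_tensor_decomposition:
  assumes "2 * b \<noteq> -1"
  shows "sl2_isomorphic (tensor_action (module_M' b) natural_action)
    (direct_sum_action (module_M' (b - 1/2)) (module_M' (b + 1/2)))"
  unfolding module_M'_eq
proof (rule pair_action_decomposable[OF shift_module_M' shift_module_M' shift_module_M'])
  \<comment> \<open>Here e12 acts with coefficient 1 throughout, so \<open>U\<close> must be
    constant and \<open>V\<close> linear with slope \<open>- U\<close>: \<open>U1 = -1\<close>,
    \<open>V1 = h + b + 1/2\<close>, \<open>U2 = 1\<close>, \<open>V2 = b + 1/2 - h\<close>.\<close>
  show "- 1 * [:b + 1/2, -1:] - 1 * [:b + 1/2, 1:] = [:- (2 * b + 1):]"
    by (simp add: algebra_simps one_pCons)
  show "- (2 * b + 1) \<noteq> 0"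
    using assms by (simp only: neg_equal_0_iff_equal eq_neg_iff_add_eq_0 not_False_eq_True)
qed (rule sl2_hom_from_pair[OF shift_module_M' shift_module_M'];
    simp add: field_simps)+

lemma module_M_tensor_extension:
  "\<exists>f g. short_exact (module_M 0) (tensor_action (module_M (-1/2)) natural_action) (module_M (-1)) f g \<and>
     \<not> splits (tensor_action (module_M (-1/2)) natural_action) (module_M (-1)) g"
  unfolding module_M_eq
proof (rule short_exact_tensor[OF shift_module_M])
  \<comment> \<open>Here \<open>P\<close> is the constant 1, written \<open>[:1:]\<close> so that
    removing factors \<open>1\<close> does not erase it. The map \<open>g\<close> below is the
    negative of the map to \<open>b - 1/2\<close> in the decomposition, taken at
    \<open>b = -1/2\<close>.\<close>
  have f: "sl2_hom (shift_action [:0, 1:] ([:- 0, 1:])) (pair_action [:-1/2, 1:] ([:- (-1/2), 1:]))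
      (\<lambda>f. ([:1:] * f, 1 * f))"
    by (rule sl2_hom_into_pair[OF shift_module_M shift_module_M]) (simp_all add: algebra_simps)
  have g: "sl2_hom (pair_action [:-1/2, 1:] ([:- (-1/2), 1:])) (shift_action [:-1, 1:] ([:- (-1), 1:]))
      (\<lambda>p. 1 * fst p + (- [:1:]) * snd p)"
    by (rule sl2_hom_from_pair[OF shift_module_M shift_module_M]) (simp_all add: algebra_simps)
  note ext = nonsplit_extension_pair[OF f[unfolded mult_1_left]
      g[unfolded mult_1_left mult_minus_left add_uminus_conv_diff]]
  show "short_exact (shift_action [:0, 1:] ([:- 0, 1:])) (pair_action [:-1/2, 1:] ([:- (-1/2), 1:])) (shift_action [:-1, 1:] ([:- (-1), 1:]))
      (\<lambda>f. ([:1:] * f, f)) (\<lambda>p. fst p - [:1:] * snd p)"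
    by (rule ext) simp_all
  show "\<not> splits (pair_action [:-1/2, 1:] ([:- (-1/2), 1:])) (shift_action [:-1, 1:] ([:- (-1), 1:])) (\<lambda>p. fst p - [:1:] * snd p)"
    by (rule ext) simp_all
qed

lemma module_M'_tensor_extension:
  "\<exists>f g. short_exact (module_M' 0) (tensor_action (module_M' (-1/2)) natural_action) (module_M' (-1)) f g \<and>
     \<not> splits (tensor_action (module_M' (-1/2)) natural_action) (module_M' (-1)) g"
  unfolding module_M'_eq
proof (rule short_exact_tensor[OF shift_module_M'])
  \<comment> \<open>Now \<open>P = h\<close>: at \<open>b = -1/2\<close> the decomposition's map to
    \<open>b - 1/2\<close> has coefficients \<open>-1\<close> and \<open>h\<close>, and its negative
    is \<open>g\<close>.\<close>
  have f: "sl2_hom (shift_action 1 ([:0 + 1, 1:] * [:- 0, 1:])) (pair_action 1 ([:-1/2 + 1, 1:] * [:- (-1/2), 1:]))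
      (\<lambda>f. ([:0, 1:] * f, 1 * f))"
    by (rule sl2_hom_into_pair[OF shift_module_M' shift_module_M']) (simp_all add: algebra_simps)
  have g: "sl2_hom (pair_action 1 ([:-1/2 + 1, 1:] * [:- (-1/2), 1:])) (shift_action 1 ([:-1 + 1, 1:] * [:- (-1), 1:]))
      (\<lambda>p. 1 * fst p + (- [:0, 1:]) * snd p)"
    by (rule sl2_hom_from_pair[OF shift_module_M' shift_module_M']) (simp_all add: algebra_simps)
  note ext = nonsplit_extension_pair[OF f[unfolded mult_1_left]
      g[unfolded mult_1_left mult_minus_left add_uminus_conv_diff]]
  show "short_exact (shift_action 1 ([:0 + 1, 1:] * [:- 0, 1:])) (pair_action 1 ([:-1/2 + 1, 1:] * [:- (-1/2), 1:])) (shift_action 1 ([:-1 + 1, 1:] * [:- (-1), 1:]))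
      (\<lambda>f. ([:0, 1:] * f, f)) (\<lambda>p. fst p - [:0, 1:] * snd p)"
    by (rule ext) simp_all
  show "\<not> splits (pair_action 1 ([:-1/2 + 1, 1:] * [:- (-1/2), 1:])) (shift_action 1 ([:-1 + 1, 1:] * [:- (-1), 1:])) (\<lambda>p. fst p - [:0, 1:] * snd p)"
    by (rule ext) simp_all
qed

theorem proposition17:
  fixes N :: "complex \<Rightarrow> complex poly sl2_action"
  assumes "N = module_M \<or> N = module_M'"
  shows "(\<forall>b. 2 * b \<noteq> -1 \<longrightarrow>
            sl2_isomorphic (tensor_action (N b) natural_action)
              (direct_sum_action (N (b - 1/2)) (N (b + 1/2)))) \<and>
         (\<exists>f g. short_exact (N 0) (tensor_action (N (-1/2)) natural_action) (N (-1)) f g \<and>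
            \<not> splits (tensor_action (N (-1/2)) natural_action) (N (-1)) g)"
  using assms module_M_tensor_decomposition module_M_tensor_extension
    module_M'_tensor_decomposition module_M'_tensor_extension
  by blast

end
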